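(* Assume $(\omega, \mathcal{F})$ is a nondegenerate Ramsey algebra and $\mathcal{F}$ is countable. Suppose $S_n$ is a countable collection of subsets of $\omega^n$ for every $n \geq 1$. Then there exists an admissible $\mathfrak{A}=\{ \mathcal{A}_n \}_{n\geq 1}$ such that (1) $\mathcal{A}_n$ is a countable superset of $S_n$ for every $n \geq 1$; (2) every operation in $\mathcal{F}$ is an $\mathfrak{A}$-operation; (3) there exists a nonprincipal $\mathfrak{A}$-ultrafilter $U$ that is strongly reductible for $\mathcal{F}$.
   Context: $\omega=\{0,1,2,\dots\}$; tuples are identified so that $\omega^{n}=\omega^{n-1}\times\omega$ and the 1-tuple $(x)$ is $x$. A field of sets over a set $S$ is a nonempty collection of subsets of $S$ closed under finite unions, finite intersections and complementation relative to $S$; by convention every field of sets is assumed to contain all singletons. An ultrafilter on a field of sets $\mathcal{A}$ over $S$ is a subset $U\subseteq\mathcal{A}$ closed under (finite) intersections with $S\in U$, $\emptyset\notin U$, and for every $X\in\mathcal{A}$ either $X\in U$ or $S\setminus X\in U$. It is principal if it equals $\{X\in\mathcal{A}\mid a\in X\}$ for some $a\in S$, and nonprincipal otherwise. Algebras and reductions. An algebra $(A,\mathcal{F})$ is a nonempty set $A$ with a collection $\mathcal{F}$ of operations on $A$ (each of some finite arity $\geq 1$). An operation $f$ is an orderly composition of a collection $\mathcal{G}$ of operations if there are $g,h_1,\dots,h_n\in\mathcal{G}$ with $f(\bar x_1,\dots,\bar x_n)=g(h_1(\bar x_1),\dots,h_n(\bar x_n))$, where $\bar x_1,\dots,\bar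 x_n$ are consecutive disjoint lists of variables of the appropriate lengths. The collection of orderly terms over $\mathcal{F}$ is the smallest collection of operations on $A$ that includes $\mathcal{F}$, contains the identity function on $A$, and is closed under orderly composition. For infinite sequences $\vec a,\vec b$ in $A$, $\vec a\leq_{\mathcal{F}}\vec b$ means that there are finite sequences $\vec b_n$ and orderly terms $f_n$ over $\mathcal{F}$ ($n\in\omega$) such that the concatenation $\vec b_0*\vec b_1*\vec b_2*\cdots$ is a subsequence of $\vec b$ and $\vec a(n)=f_n(\vec b_n)$ for all $n$ (the length of $\vec b_n$ being the arity of $f_n$). $\mathrm{FR}_{\mathcal{F}}(\vec b)$ is the set of all $f(\vec b_0)$ with $f$ an orderly term over $\mathcal{F}$ and $\vec b_0$ a finite subsequence of $\vec b$ of length the arity of $f$. $\vec a-i$ denotes the sequence $\langle \vec a(i),\vec a(i+1),\dots\rangle$. $(A,\mathcal{F})$ is a Ramsey algebra if for every infinite sequence $\vec a$ in $A$ and every $X\subseteq A$ there is $\vec b\leq_{\mathcal{F}}\vec a$ such that $\mathrm{FR}_{\mathcal{F}}(\vec b)$ is contained in or disjoint from $X$. It is a degenerate Ramsey algebra if for every infinite sequence $\vec a$ in $A$ there is $\vec b\leq_{\mathcal{F}}\vec a$ with $|\mathrm{FR}_{\mathcal{F}}(\vec b)|=1$; a nondegenerate Ramsey algebra is a Ramsey algebra that is not degenerate. Admissibility. $\mathfrak{A}=\{\mathcal{A}_n\}_{n\geq1}$, where each $\mathcal{A}_n$ is a field of sets over $\omega^n$, is admissible if for every $n\geq 2$ and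 $X\in\mathcal{A}_n$: (i) $\{(a_2,\dots,a_n,a_1)\mid(a_1,\dots,a_n)\in X\}\in\mathcal{A}_n$; and (ii) for all $a_1\in\omega$, $\{(a_2,\dots,a_n)\mid(a_1,\dots,a_n)\in X\}\in\mathcal{A}_{n-1}$. For admissible $\mathfrak{A}$, an $\mathfrak{A}$-ultrafilter is an ultrafilter $U$ on $\mathcal{A}_1$ such that for every $n\geq1$ and $X\in\mathcal{A}_{n+1}$, $\{(a_1,\dots,a_n)\in\omega^n\mid\{a_{n+1}\in\omega\mid(a_1,\dots,a_{n+1})\in X\}\in U\}\in\mathcal{A}_n$. An $m$-ary operation $f$ on $\omega$ is an $\mathfrak{A}$-operation if for every $n\geq1$ and $X\in\mathcal{A}_n$, $\{(a_1,\dots,a_{n+m-1})\mid(a_1,\dots,a_{n-1},f(a_n,\dots,a_{n+m-1}))\in X\}\in\mathcal{A}_{n+m-1}$. An ultrafilter $U$ on a field of sets over $\omega$ is strongly reductible for $\mathcal{F}$ if for every $X\in U$ there is an infinite sequence $\vec a$ in $\omega$ such that $\mathrm{FR}_{\mathcal{F}}(\vec a)\subseteq X$ and $\mathrm{FR}_{\mathcal{F}}(\vec a-i)\in U$ for all $i\in\omega$. *)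

theory Defs
  imports "HOL-Analysis.Sigma_Algebra"
begin

text \<open>
  An algebra is a set of operations on the carrier type \<open>'a\<close>. An operation is a pair of its
  arity and a function on argument lists. The function is required to be extensional, so that
  two operations that agree on all lists of the right length are equal, and countability of a
  set of operations means what it should.
\<close>

type_synonym 'a operation = "nat \<times> ('a list \<Rightarrow> 'a)"

abbreviation arity :: "'a operation \<Rightarrow> nat" where
  "arity \<equiv> fst"

abbreviation apply_op :: "'a operation \<Rightarrow> 'a list \<Rightarrow> 'a" where
  "apply_op \<equiv> snd"

definition tuples :: "nat \<Rightarrow> 'a list set" where
  "tuples n = {xs. length xs = n}"

definition is_operation :: "'a operation \<Rightarrow> bool" where
  "is_operation f \<longleftrightarrow> 1 \<le> arity f \<and> apply_op f \<in> extensional (tuples (arity f))"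

definition operation_algebra :: "'a operation set \<Rightarrow> bool" where
  "operation_algebra F \<longleftrightarrow> (\<forall>f\<in>F. is_operation f)"

definition id_operation :: "'a operation" where
  "id_operation = (1, restrict hd (tuples 1))"

definition orderly_composition ::
    "'a operation \<Rightarrow> 'a operation \<Rightarrow> 'a operation list \<Rightarrow> bool" where
  "orderly_composition f g hs \<longleftrightarrow>
     is_operation f \<and> arity g = length hs \<and> arity f = sum_list (map arity hs) \<and>
     (\<forall>xss. map length xss = map arity hs \<longrightarrow>
        apply_op f (concat xss) = apply_op g (map2 apply_op hs xss))"

inductive_set orderly_terms :: "'a operation set \<Rightarrow> 'a operation set"
  for F :: "'a operation set" where
  base: "f \<in> F \<Longrightarrow> f \<in> orderly_terms F"
| identity: "id_operation \<in> orderly_terms F"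
| composition: "\<lbrakk>g \<in> orderly_terms F; \<forall>h\<in>set hs. h \<in> orderly_terms F;
    orderly_composition f g hs\<rbrakk> \<Longrightarrow> f \<in> orderly_terms F"

text \<open>
  The concatenation of infinitely many nonempty lists: its \<open>k\<close>-th entry already occurs in the
  concatenation of the first \<open>k + 1\<close> lists. It is only used for lists whose lengths are arities,
  hence positive.
\<close>

definition seq_concat :: "(nat \<Rightarrow> 'a list) \<Rightarrow> nat \<Rightarrow> 'a" where
  "seq_concat bs k = concat (map bs [0..<Suc k]) ! k"

definition subsequence :: "(nat \<Rightarrow> 'a) \<Rightarrow> (nat \<Rightarrow> 'a) \<Rightarrow> bool" where
  "subsequence c b \<longleftrightarrow> (\<exists>r. strict_mono r \<and> c = b \<circ> r)"

definition finite_subsequence :: "'a list \<Rightarrow> (nat \<Rightarrow> 'a) \<Rightarrow> bool" where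
  "finite_subsequence xs b \<longleftrightarrow> (\<exists>ks. sorted_wrt (<) ks \<and> xs = map b ks)"

definition reduction :: "'a operation set \<Rightarrow> (nat \<Rightarrow> 'a) \<Rightarrow> (nat \<Rightarrow> 'a) \<Rightarrow> bool" where
  "reduction F a b \<longleftrightarrow>
     (\<exists>bs fs. (\<forall>n. fs n \<in> orderly_terms F \<and> length (bs n) = arity (fs n)
                  \<and> a n = apply_op (fs n) (bs n))
            \<and> subsequence (seq_concat bs) b)"

definition FR :: "'a operation set \<Rightarrow> (nat \<Rightarrow> 'a) \<Rightarrow> 'a set" where
  "FR F b = {apply_op f xs | f xs.
     f \<in> orderly_terms F \<and> finite_subsequence xs b \<and> length xs = arity f}"

definition tail_seq :: "(nat \<Rightarrow> 'a) \<Rightarrow> nat \<Rightarrow> nat \<Rightarrow> 'a" where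
  "tail_seq a i = (\<lambda>k. a (i + k))"

definition ramsey_algebra :: "'a operation set \<Rightarrow> bool" where
  "ramsey_algebra F \<longleftrightarrow> operation_algebra F \<and>
     (\<forall>a X. \<exists>b. reduction F b a \<and> (FR F b \<subseteq> X \<or> FR F b \<inter> X = {}))"

definition degenerate_ramsey_algebra :: "'a operation set \<Rightarrow> bool" where
  "degenerate_ramsey_algebra F \<longleftrightarrow> operation_algebra F \<and>
     (\<forall>a. \<exists>b. reduction F b a \<and> card (FR F b) = 1)"

definition nondegenerate_ramsey_algebra :: "'a operation set \<Rightarrow> bool" where
  "nondegenerate_ramsey_algebra F \<longleftrightarrow> ramsey_algebra F \<and> \<not> degenerate_ramsey_algebra F"

text \<open>The locale predicate \<^const>\<open>algebra\<close> is the library's notion of a field of sets.\<close>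

definition field_of_sets :: "'a set \<Rightarrow> 'a set set \<Rightarrow> bool" where
  "field_of_sets S A \<longleftrightarrow> algebra S A \<and> (\<forall>s\<in>S. {s} \<in> A)"

definition ultrafilter_on :: "'a set \<Rightarrow> 'a set set \<Rightarrow> 'a set set \<Rightarrow> bool" where
  "ultrafilter_on S A U \<longleftrightarrow>
     U \<subseteq> A \<and> (\<forall>X\<in>U. \<forall>Y\<in>U. X \<inter> Y \<in> U) \<and> S \<in> U \<and> {} \<notin> U \<and>
     (\<forall>X\<in>A. X \<in> U \<or> S - X \<in> U)"

definition principal_on :: "'a set \<Rightarrow> 'a set set \<Rightarrow> 'a set set \<Rightarrow> bool" where
  "principal_on S A U \<longleftrightarrow> (\<exists>a\<in>S. U = {X \<in> A. a \<in> X})"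

text \<open>
  A family \<open>A\<close> gives for each \<open>n \<ge> 1\<close> a collection \<open>A n\<close> of sets of \<open>n\<close>-tuples, tuples being
  lists; the value \<open>A 0\<close> is irrelevant and unconstrained.
\<close>

definition admissible_family :: "(nat \<Rightarrow> nat list set set) \<Rightarrow> bool" where
  "admissible_family A \<longleftrightarrow>
     (\<forall>n\<ge>1. field_of_sets (tuples n) (A n)) \<and>
     (\<forall>n\<ge>2. \<forall>X\<in>A n.
        {as @ [a] | a as. a # as \<in> X} \<in> A n \<and>
        (\<forall>a. {as. a # as \<in> X} \<in> A (n - 1)))"

text \<open>The field \<open>A 1\<close>, seen as a field of sets over \<open>nat\<close> by identifying \<open>[x]\<close> with \<open>x\<close>.\<close>

definition unary_field :: "(nat \<Rightarrow> nat list set set) \<Rightarrow> nat set set" where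
  "unary_field A = {X. (\<lambda>x. [x]) ` X \<in> A 1}"

definition family_ultrafilter :: "(nat \<Rightarrow> nat list set set) \<Rightarrow> nat set set \<Rightarrow> bool" where
  "family_ultrafilter A U \<longleftrightarrow>
     ultrafilter_on UNIV (unary_field A) U \<and>
     (\<forall>n\<ge>1. \<forall>X\<in>A (n + 1). {as \<in> tuples n. {a. as @ [a] \<in> X} \<in> U} \<in> A n)"

definition family_operation :: "(nat \<Rightarrow> nat list set set) \<Rightarrow> nat operation \<Rightarrow> bool" where
  "family_operation A f \<longleftrightarrow>
     (\<forall>n\<ge>1. \<forall>X\<in>A n.
        {as @ bs | as bs. as \<in> tuples (n - 1) \<and> bs \<in> tuples (arity f) \<and>
           as @ [apply_op f bs] \<in> X} \<in> A (n + arity f - 1))"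

definition strongly_reductible :: "'a operation set \<Rightarrow> 'a set set \<Rightarrow> bool" where
  "strongly_reductible F U \<longleftrightarrow>
     (\<forall>X\<in>U. \<exists>a. FR F a \<subseteq> X \<and> (\<forall>i. FR F (tail_seq a i) \<in> U))"

end

theory Submission
  imports Defs
begin

text \<open>
  Iterating the Ramsey property and diagonalising, every sequence \<open>d\<close> has a reduction \<open>d'\<close> that
  decides countably many sets: each of them contains \<open>FR (d' - j)\<close> or is disjoint from it for some
  \<open>j\<close>. Since a reduction \<open>d'\<close> of \<open>d\<close> satisfies \<open>FR (d' - j) \<subseteq> FR (d - j)\<close>, such decisions persist under
  further reductions. One therefore builds a chain of countable families \<open>A k\<close> and sequences
  \<open>d k\<close>, each \<open>d (k + 1)\<close> reducing \<open>d k\<close>, where \<open>d k\<close> decides the sections of the sets in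
  \<open>A k\<close> and \<open>A (k + 1)\<close> contains the sets required by one application of each closure condition,
  including the closure under the ultrafilter quantifier as decided by \<open>d k\<close> and all the sets
  \<open>FR (d k - j)\<close>. In the limit the sets \<open>FR (d k - j)\<close> generate the ultrafilter, and membership
  of \<open>FR (d k - j)\<close> in it is strong reductibility. Starting below a sequence that witnesses
  nondegeneracy keeps all \<open>FR (d k - j)\<close> from being singletons, so the ultrafilter is nonprincipal.
\<close>

section \<open>Reductions in terms of blocks of indices\<close>

lemma is_operation_orderly_terms:
  assumes "operation_algebra F" "f \<in> orderly_terms F"
  shows "is_operation f"
  using assms(2,1)
  by (induction rule: orderly_terms.induct)
    (auto simp: operation_algebra_def is_operation_def id_operation_def orderly_composition_def)

section \<open>Composites of operations as operations on flat argument lists\<close>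

fun chop :: "nat list \<Rightarrow> 'a list \<Rightarrow> 'a list list" where
  "chop [] xs = []"
| "chop (n # ns) xs = take n xs # chop ns (drop n xs)"

lemma chop_concat: "chop (map length xss) (concat xss) = xss"
  by (induction xss) auto

text \<open>\<open>orderly_composition\<close> only specifies values on concatenations, so a
  composite has to be exhibited. A flat argument list is split by \<open>chop\<close> according to
  the inner arities, which undoes \<open>concat\<close>. The composite has positive arity because
  there is at least one inner operation and each has positive arity.\<close>

lemma ex_orderly_composition:
  assumes "arity g = length hs" "1 \<le> arity g" "\<And>h. h \<in> set hs \<Longrightarrow> is_operation h"
  shows "\<exists>f. orderly_composition f g hs"
proof -
  define f where "f = (sum_list (map arity hs),
    restrict (\<lambda>xs. apply_op g (map2 apply_op hs (chop (map arity hs) xs)))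
      (tuples (sum_list (map arity hs))))"
  obtain h hs' where "hs = h # hs'" using assms(1,2) by (cases hs) auto
  then have "1 \<le> sum_list (map arity hs)"
    using assms(3)[of h] by (auto simp: is_operation_def)
  moreover have "apply_op f (concat xss) = apply_op g (map2 apply_op hs xss)"
    if "map length xss = map arity hs" for xss
  proof -
    have "length (concat xss) = sum_list (map arity hs)"
      by (simp add: length_concat that)
    moreover have "chop (map arity hs) (concat xss) = xss"
      using chop_concat[of xss] that by simp
    ultimately show ?thesis by (simp add: f_def tuples_def)
  qed
  ultimately have "orderly_composition f g hs"
    using assms(1) by (auto simp: orderly_composition_def is_operation_def f_def)
  then show ?thesis ..
qed

text \<open>A localised form of \<open>FR\<close> that records an interval containing the indices
  used. Reductions then amount to increasing sequences of interval bounds, and composing reductions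
  amounts to composing these sequences.\<close>

definition block :: "'a operation set \<Rightarrow> (nat \<Rightarrow> 'a) \<Rightarrow> nat \<Rightarrow> nat \<Rightarrow> 'a set" where
  "block F b m n = {apply_op f (map b ks) | f ks.
     f \<in> orderly_terms F \<and> length ks = arity f \<and> sorted_wrt (<) ks \<and> set ks \<subseteq> {m..<n}}"

lemma blockI:
  assumes "f \<in> orderly_terms F" "length ks = arity f" "sorted_wrt (<) ks" "set ks \<subseteq> {m..<n}"
  shows "apply_op f (map b ks) \<in> block F b m n"
  using assms unfolding block_def by blast

lemma block_mono: "m' \<le> m \<Longrightarrow> n \<le> n' \<Longrightarrow> block F b m n \<subseteq> block F b m' n'"
  unfolding block_def by fastforce

lemma block_tail_seq:
  assumes "m \<ge> i" "x \<in> block F b m n"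
  shows "x \<in> block F (tail_seq b i) (m - i) (n - i)"
proof -
  obtain f ks where f: "f \<in> orderly_terms F" "length ks = arity f" "sorted_wrt (<) ks"
    "set ks \<subseteq> {m..<n}" "x = apply_op f (map b ks)"
    using assms(2) by (auto simp: block_def)
  define ls where "ls = map (\<lambda>k. k - i) ks"
  have eq: "map (tail_seq b i) ls = map b ks"
    using f(4) assms(1) by (auto simp: ls_def tail_seq_def subset_iff)
  have "sorted_wrt (<) ls"
    using f(4) assms(1) unfolding ls_def sorted_wrt_map
    by (intro sorted_wrt_mono_rel[OF _ f(3)]) (fastforce simp: subset_iff)
  moreover have "set ls \<subseteq> {m - i..<n - i}"
    using f(4) assms(1) by (force simp: ls_def subset_iff)
  ultimately have "apply_op f (map (tail_seq b i) ls) \<in> block F (tail_seq b i) (m - i) (n - i)"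
    using f(1,2) by (intro blockI) (simp_all add: ls_def)
  then show ?thesis by (simp only: eq f(5))
qed

lemma FR_eq_Union_block: "FR F b = (\<Union>n. block F b 0 n)"
proof
  show "FR F b \<subseteq> (\<Union>n. block F b 0 n)"
  proof
    fix x assume "x \<in> FR F b"
    then obtain f ks where f: "f \<in> orderly_terms F" "length ks = arity f" "sorted_wrt (<) ks"
      "x = apply_op f (map b ks)"
      by (auto simp: FR_def finite_subsequence_def)
    have "set ks \<subseteq> {0..<Suc (Max (set ks))}"
      by (auto simp: less_Suc_eq_le)
    then show "x \<in> (\<Union>n. block F b 0 n)"
      using f unfolding block_def by blast
  qed
  show "(\<Union>n. block F b 0 n) \<subseteq> FR F b"
    unfolding block_def FR_def finite_subsequence_def by force
qed

text \<open>The identity is an orderly term; for this reason tails of a sequence are reductions of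
  it.\<close>

lemma in_block_self: "b n \<in> block F b n (Suc n)"
  using blockI[OF orderly_terms.identity, where ks = "[n]" and b = b and m = n and n = "Suc n"]
  by (simp add: id_operation_def tuples_def)

lemma sorted_concat_map:
  fixes l :: "nat \<Rightarrow> nat list"
  assumes "mono N" "\<And>k. sorted_wrt (<) (l k)" "\<And>k. set (l k) \<subseteq> {N k..<N (Suc k)}"
  shows "sorted_wrt (<) ks \<Longrightarrow> sorted_wrt (<) (concat (map l ks))"
proof (induction ks)
  case (Cons k ks)
  have "x < y" if "x \<in> set (l k)" "k' \<in> set ks" "y \<in> set (l k')" for x y k'
  proof -
    have "x < N (Suc k)" using that(1) assms(3)[of k] by auto
    also have "N (Suc k) \<le> N k'" using Cons.prems that(2) by (intro monoD[OF assms(1)]) auto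
    also have "N k' \<le> y" using that(3) assms(3)[of k'] by auto
    finally show ?thesis .
  qed
  then show ?case using Cons assms(2) by (auto simp: sorted_wrt_append)
qed simp

text \<open>Substituting the terms that produce the entries of \<open>a\<close> from
  \<open>b\<close> into a term over \<open>a\<close> yields an orderly composition. Its arguments
  are listed by the concatenated index lists, which stay increasing because they come from
  consecutive intervals.\<close>

lemma block_trans:
  assumes F: "operation_algebra F" and N: "mono N"
    and a: "\<And>k. a k \<in> block F b (N k) (N (Suc k))" and x: "x \<in> block F a m n"
  shows "x \<in> block F b (N m) (N n)"
proof -
  obtain f ks where f: "f \<in> orderly_terms F" "length ks = arity f" "sorted_wrt (<) ks"
    "set ks \<subseteq> {m..<n}" "x = apply_op f (map a ks)"
    using x by (auto simp: block_def)
  have "\<forall>k. \<exists>g l. g \<in> orderly_terms F \<and> length l = arity g \<and> sorted_wrt (<) l \<and>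
      set l \<subseteq> {N k..<N (Suc k)} \<and> a k = apply_op g (map b l)"
    using a unfolding block_def by blast
  then obtain g l where g: "\<And>k. g k \<in> orderly_terms F" "\<And>k. length (l k) = arity (g k)"
    "\<And>k. sorted_wrt (<) (l k)" "\<And>k. set (l k) \<subseteq> {N k..<N (Suc k)}"
    "\<And>k. a k = apply_op (g k) (map b (l k))"
    by metis
  have "1 \<le> arity f"
    using is_operation_orderly_terms[OF F f(1)] by (simp add: is_operation_def)
  then obtain h where h: "orderly_composition h f (map g ks)"
    using ex_orderly_composition[of f "map g ks"] f(2) is_operation_orderly_terms[OF F g(1)]
    by (metis ex_map_conv length_map)
  define xss where "xss = map (\<lambda>k. map b (l k)) ks"
  have "h \<in> orderly_terms F"
    using orderly_terms.composition[OF f(1) _ h] g(1) by auto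
  moreover have "length (concat (map l ks)) = arity h"
    using h by (simp add: orderly_composition_def length_concat comp_def g(2))
  moreover have "sorted_wrt (<) (concat (map l ks))"
    by (rule sorted_concat_map[OF N g(3,4) f(3)])
  moreover have "set (concat (map l ks)) \<subseteq> {N m..<N n}"
  proof
    fix y assume "y \<in> set (concat (map l ks))"
    then obtain k where k: "k \<in> set ks" "y \<in> set (l k)" by auto
    then have "N m \<le> N k" "N (Suc k) \<le> N n"
      using f(4) by (auto intro!: monoD[OF N])
    then show "y \<in> {N m..<N n}" using k(2) g(4)[of k] by auto
  qed
  moreover have "x = apply_op h (map b (concat (map l ks)))"
  proof -
    have "map length xss = map arity (map g ks)"
      by (simp add: xss_def g(2))
    then have "apply_op h (concat xss) = apply_op f (map2 apply_op (map g ks) xss)"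
      using h by (simp add: orderly_composition_def)
    also have "map2 apply_op (map g ks) xss = map a ks"
      by (auto simp: xss_def map2_map_map g(5))
    finally show ?thesis
      by (simp add: f(5) xss_def map_concat comp_def)
  qed
  ultimately show ?thesis unfolding block_def by blast
qed

section \<open>Concatenations of infinitely many nonempty lists\<close>

lemma length_concat_upt_ge:
  assumes "\<And>n. bs n \<noteq> []"
  shows "n \<le> length (concat (map bs [0..<n]))"
proof (induction n)
  case (Suc n)
  then show ?case using assms[of n] by (cases "bs n") auto
qed simp

lemma concat_upt_nth:
  assumes "m \<le> n" "k < length (concat (map bs [0..<m]))"
  shows "concat (map bs [0..<n]) ! k = concat (map bs [0..<m]) ! k"
proof -
  have "[0..<n] = [0..<m] @ [m..<n]"
    using assms(1) upt_add_eq_append[of 0 m "n - m"] by simp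
  then show ?thesis using assms(2) by (simp add: nth_append)
qed

text \<open>The cutoff \<open>Suc k\<close> in \<open>seq_concat\<close> is immaterial: any two
  finite concatenations are prefixes of one another in some order, and both are long enough to
  contain position \<open>k\<close>.\<close>

lemma seq_concat_nth:
  assumes "\<And>n. bs n \<noteq> []" "k < length (concat (map bs [0..<n]))"
  shows "seq_concat bs k = concat (map bs [0..<n]) ! k"
proof -
  have "k < length (concat (map bs [0..<Suc k]))"
    using length_concat_upt_ge[of bs "Suc k"] assms(1) by simp
  then show ?thesis
    unfolding seq_concat_def using assms(2) concat_upt_nth
    by (metis nat_le_linear)
qed

lemma map_seq_concat:
  fixes bs
  defines "off n \<equiv> length (concat (map bs [0..<n]))"
  assumes "\<And>n. bs n \<noteq> []"
  shows "bs n = map (seq_concat bs) [off n..<off (Suc n)]"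
proof (rule nth_equalityI)
  show "length (bs n) = length (map (seq_concat bs) [off n..<off (Suc n)])"
    by (simp add: off_def)
  fix i assume i: "i < length (bs n)"
  then have "off n + i < off (Suc n)" by (simp add: off_def)
  moreover from this have "seq_concat bs (off n + i) = concat (map bs [0..<Suc n]) ! (off n + i)"
    by (intro seq_concat_nth assms) (simp add: off_def)
  ultimately show "bs n ! i = map (seq_concat bs) [off n..<off (Suc n)] ! i"
    by (simp add: off_def nth_append)
qed

lemma seq_concat_map:
  assumes "\<And>n. ks n \<noteq> []"
  shows "seq_concat (\<lambda>n. map b (ks n)) = b \<circ> seq_concat ks"
proof
  fix k
  have "concat (map (\<lambda>n. map b (ks n)) [0..<Suc k]) = map b (concat (map ks [0..<Suc k]))"
    by (simp add: map_concat comp_def)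
  moreover have "k < length (concat (map ks [0..<Suc k]))"
    using length_concat_upt_ge[of ks "Suc k"] assms by simp
  ultimately show "seq_concat (\<lambda>n. map b (ks n)) k = (b \<circ> seq_concat ks) k"
    unfolding seq_concat_def by (simp only: nth_map comp_def)
qed

lemma strict_mono_seq_concat:
  fixes ks :: "nat \<Rightarrow> nat list"
  assumes "\<And>n. ks n \<noteq> []" "\<And>n. sorted_wrt (<) (concat (map ks [0..<n]))"
  shows "strict_mono (seq_concat ks)"
proof (rule strict_monoI)
  fix i j :: nat assume "i < j"
  have j: "j < length (concat (map ks [0..<Suc j]))"
    using length_concat_upt_ge[of ks "Suc j"] assms(1) by simp
  then have "seq_concat ks i = concat (map ks [0..<Suc j]) ! i"
    "seq_concat ks j = concat (map ks [0..<Suc j]) ! j"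
    using \<open>i < j\<close> by (intro seq_concat_nth assms; simp)+
  then show "seq_concat ks i < seq_concat ks j"
    using sorted_wrt_nth_less[OF assms(2) \<open>i < j\<close> j] by simp
qed

text \<open>From left to right, \<open>N n\<close> is the index in \<open>b\<close> of the position
  where the list \<open>bs n\<close> starts in the concatenation. From right to left, the index
  lists taken from the consecutive intervals concatenate to the strictly increasing map that defines
  the subsequence.\<close>

lemma reduction_iff_block:
  assumes F: "operation_algebra F"
  shows "reduction F a b \<longleftrightarrow>
    (\<exists>N. strict_mono N \<and> (\<forall>n. a n \<in> block F b (N n) (N (Suc n))))"
proof
  assume "reduction F a b"
  then obtain bs fs r where fs: "\<And>n. fs n \<in> orderly_terms F"
      "\<And>n. length (bs n) = arity (fs n)" "\<And>n. a n = apply_op (fs n) (bs n)"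
    and r: "strict_mono r" "seq_concat bs = b \<circ> r"
    unfolding reduction_def subsequence_def by blast
  have ne: "bs n \<noteq> []" for n
    using is_operation_orderly_terms[OF F fs(1)[of n]] fs(2)[of n] by (auto simp: is_operation_def)
  define off where "off n = length (concat (map bs [0..<n]))" for n
  have off: "off n < off (Suc n)" for n using ne[of n] by (simp add: off_def)
  have "a n \<in> block F b (r (off n)) (r (off (Suc n)))" for n
  proof -
    let ?ks = "map r [off n..<off (Suc n)]"
    have "bs n = map b ?ks"
      using map_seq_concat[of bs n, OF ne] r(2) by (simp add: off_def)
    moreover have "sorted_wrt (<) ?ks"
      by (simp add: sorted_wrt_map strict_mono_less[OF r(1)])
    moreover have "set ?ks \<subseteq> {r (off n)..<r (off (Suc n))}"
      by (auto simp: strict_mono_less[OF r(1)] strict_mono_less_eq[OF r(1)])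
    ultimately show ?thesis
      using fs[of n] unfolding block_def
      by (intro CollectI exI[of _ "fs n"] exI[of _ ?ks]) (metis length_map)
  qed
  moreover have "strict_mono (\<lambda>n. r (off n))"
    using off by (simp add: strict_mono_Suc_iff strict_mono_less[OF r(1)])
  ultimately show "\<exists>N. strict_mono N \<and> (\<forall>n. a n \<in> block F b (N n) (N (Suc n)))"
    by (intro exI[of _ "\<lambda>n. r (off n)"]) auto
next
  assume "\<exists>N. strict_mono N \<and> (\<forall>n. a n \<in> block F b (N n) (N (Suc n)))"
  then obtain N where N: "strict_mono N" "\<And>n. a n \<in> block F b (N n) (N (Suc n))" by blast
  have "\<forall>n. \<exists>g l. g \<in> orderly_terms F \<and> length l = arity g \<and> sorted_wrt (<) l \<and>
      set l \<subseteq> {N n..<N (Suc n)} \<and> a n = apply_op g (map b l)"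
    using N(2) unfolding block_def by blast
  then obtain g l where g: "\<And>k. g k \<in> orderly_terms F" "\<And>k. length (l k) = arity (g k)"
    "\<And>k. sorted_wrt (<) (l k)" "\<And>k. set (l k) \<subseteq> {N k..<N (Suc k)}"
    "\<And>k. a k = apply_op (g k) (map b (l k))"
    by metis
  have ne: "l n \<noteq> []" for n
    using is_operation_orderly_terms[OF F g(1)[of n]] g(2)[of n] by (auto simp: is_operation_def)
  have "strict_mono (seq_concat l)"
    by (intro strict_mono_seq_concat ne
      sorted_concat_map[OF strict_mono_mono[OF N(1)] g(3,4)]) auto
  moreover have "seq_concat (\<lambda>n. map b (l n)) = b \<circ> seq_concat l"
    by (rule seq_concat_map[OF ne])
  ultimately have "subsequence (seq_concat (\<lambda>n. map b (l n))) b"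
    unfolding subsequence_def by blast
  then show "reduction F a b"
    unfolding reduction_def using g
    by (intro exI[of _ "\<lambda>n. map b (l n)"] exI[of _ g]) auto
qed

section \<open>Transitivity, tails and diagonals of reductions\<close>

lemma reduction_trans:
  assumes F: "operation_algebra F" and "reduction F a b" "reduction F b c"
  shows "reduction F a c"
proof -
  obtain N where N: "strict_mono N" "\<And>n. a n \<in> block F b (N n) (N (Suc n))"
    using assms(2) reduction_iff_block[OF F] by blast
  obtain M where M: "strict_mono M" "\<And>n. b n \<in> block F c (M n) (M (Suc n))"
    using assms(3) reduction_iff_block[OF F] by blast
  have "strict_mono (\<lambda>n. M (N n))"
    using N(1) M(1) by (simp add: strict_mono_def)
  moreover have "a n \<in> block F c (M (N n)) (M (N (Suc n)))" for n
    by (rule block_trans[OF F strict_mono_mono[OF M(1)] M(2) N(2)])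
  ultimately show ?thesis unfolding reduction_iff_block[OF F] by blast
qed

lemma reduction_tail_seq_self:
  assumes F: "operation_algebra F"
  shows "reduction F (tail_seq b i) b"
  unfolding reduction_iff_block[OF F] tail_seq_def
  by (intro exI[of _ "\<lambda>n. i + n"]) (auto simp: strict_mono_def in_block_self)

text \<open>A strictly increasing \<open>N\<close> satisfies \<open>n <= N n\<close>, so the entries
  of \<open>a\<close> from \<open>i\<close> on are built only from entries of \<open>b\<close> from
  \<open>i\<close> on.\<close>

lemma reduction_tail_seq:
  assumes F: "operation_algebra F" and "reduction F a b"
  shows "reduction F (tail_seq a i) (tail_seq b i)"
proof -
  obtain N where N: "strict_mono N" "\<And>n. a n \<in> block F b (N n) (N (Suc n))"
    using assms(2) reduction_iff_block[OF F] by blast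
  have ge: "i \<le> N (i + n)" for n
    using strict_mono_imp_increasing[OF N(1), of "i + n"] by linarith
  have "tail_seq a i n \<in> block F (tail_seq b i) (N (i + n) - i) (N (i + Suc n) - i)" for n
    using block_tail_seq[OF ge N(2)[of "i + n"]] by (simp add: tail_seq_def)
  moreover have "strict_mono (\<lambda>n. N (i + n) - i)"
    unfolding strict_mono_Suc_iff using N(1) ge by (simp add: diff_less_mono strict_mono_Suc_iff)
  ultimately show ?thesis unfolding reduction_iff_block[OF F] by blast
qed

lemma FR_reduction_subset:
  assumes F: "operation_algebra F" and "reduction F a b"
  shows "FR F a \<subseteq> FR F b"
proof
  fix x assume "x \<in> FR F a"
  then obtain n where n: "x \<in> block F a 0 n" by (auto simp: FR_eq_Union_block)
  obtain N where N: "strict_mono N" "\<And>n. a n \<in> block F b (N n) (N (Suc n))"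
    using assms(2) reduction_iff_block[OF F] by blast
  have "x \<in> block F b (N 0) (N n)"
    by (rule block_trans[OF F strict_mono_mono[OF N(1)] N(2) n])
  then have "x \<in> block F b 0 (N n)"
    using block_mono[of 0 "N 0" "N n" "N n" F b] by auto
  then show "x \<in> FR F b" by (auto simp: FR_eq_Union_block)
qed

lemma FR_nonempty: "FR F b \<noteq> {}"
  using in_block_self[of b 0 F] by (auto simp: FR_eq_Union_block)

lemma tail_seq_tail_seq: "tail_seq (tail_seq a i) j = tail_seq a (i + j)"
  by (simp add: tail_seq_def add.assoc)

lemma FR_tail_seq_antimono:
  assumes "operation_algebra F" "i \<le> j"
  shows "FR F (tail_seq a j) \<subseteq> FR F (tail_seq a i)"
  using FR_reduction_subset[OF assms(1) reduction_tail_seq_self[OF assms(1)],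
      of "tail_seq a i" "j - i"] assms(2)
  by (simp add: tail_seq_tail_seq)

text \<open>The first entry of \<open>c j\<close> is kept, and all later diagonal entries come from
  the tail of \<open>c j\<close> without it. Traced back to \<open>c 0\<close>, the diagonal entries
  therefore use disjoint, successive blocks.\<close>

lemma diagonal_reduction:
  assumes F: "operation_algebra F"
    and c: "\<And>j. reduction F (c (Suc j)) (tail_seq (c j) 1)"
  shows "reduction F (\<lambda>n. c n 0) (c 0)"
proof -
  \<comment> \<open>Passing from the tail back to \<open>c j\<close> shifts all bounds by one, hence
    \<open>1 <= N 0\<close>.\<close>
  have "\<exists>N. strict_mono N \<and> 1 \<le> N 0 \<and> (\<forall>n. c (Suc j) n \<in> block F (c j) (N n) (N (Suc n)))" for j
  proof -
    obtain N where N: "strict_mono N"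
      "\<And>n. c (Suc j) n \<in> block F (tail_seq (c j) 1) (N n) (N (Suc n))"
      using c[of j] reduction_iff_block[OF F] by blast
    have "mono Suc" by (simp add: mono_def)
    then have "c (Suc j) n \<in> block F (c j) (Suc (N n)) (Suc (N (Suc n)))" for n
      by (rule block_trans[OF F _ _ N(2)]) (use in_block_self in \<open>auto simp: tail_seq_def\<close>)
    moreover have "strict_mono (\<lambda>n. Suc (N n))"
      using N(1) by (simp add: strict_mono_def)
    ultimately show ?thesis by (intro exI[of _ "\<lambda>n. Suc (N n)"]) auto
  qed
  then obtain N where N: "\<And>j. strict_mono (N j)" "\<And>j. 1 \<le> N j 0"
    "\<And>j n. c (Suc j) n \<in> block F (c j) (N j n) (N j (Suc n))"
    by metis
  \<comment> \<open>\<open>M j\<close> translates index bounds for \<open>c j\<close> into index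
    bounds for \<open>c 0\<close> by composing the maps \<open>N\<close>.\<close>
  define M where "M = rec_nat id (\<lambda>j m. m \<circ> N j)"
  have M_Suc: "M (Suc j) = (\<lambda>n. M j (N j n))" for j by (simp add: M_def comp_def)
  have M: "strict_mono (M j) \<and> (\<forall>n. c j n \<in> block F (c 0) (M j n) (M j (Suc n)))" for j
  proof (induction j)
    case 0
    then show ?case by (auto simp: M_def strict_mono_def in_block_self)
  next
    case (Suc j)
    then have "c (Suc j) n \<in> block F (c 0) (M j (N j n)) (M j (N j (Suc n)))" for n
      by (intro block_trans[OF F _ _ N(3)]) (auto simp: strict_mono_mono)
    moreover have "strict_mono (M (Suc j))"
      using Suc N(1)[of j] by (simp add: strict_mono_def M_Suc)
    ultimately show ?case by (simp add: M_Suc)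
  qed
  \<comment> \<open>Here \<open>1 <= N j 0\<close> enters: the block giving \<open>c j 0\<close>
    ends before the block giving \<open>c (Suc j) 0\<close> begins.\<close>
  have le: "M j 1 \<le> M (Suc j) 0" for j
    using M[of j] N(2)[of j] by (simp add: M_Suc strict_mono_less_eq)
  have "strict_mono (\<lambda>j. M j 0)"
    unfolding strict_mono_Suc_iff using M le
    by (metis less_le_trans strict_mono_less zero_less_one)
  moreover have "c j 0 \<in> block F (c 0) (M j 0) (M (Suc j) 0)" for j
    using block_mono[OF order_refl le[of j]] M[of j] by fastforce
  ultimately show ?thesis unfolding reduction_iff_block[OF F] by blast
qed

section \<open>Deciding countably many sets\<close>

text \<open>The sets forced by \<open>d\<close> form the filter generated by the sets
  \<open>FR\<close> of the tails of \<open>d\<close>.\<close>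

definition forces :: "'a operation set \<Rightarrow> (nat \<Rightarrow> 'a) \<Rightarrow> 'a set \<Rightarrow> bool" where
  "forces F d Y \<longleftrightarrow> (\<exists>j. FR F (tail_seq d j) \<subseteq> Y)"

lemma forces_reduction:
  assumes "operation_algebra F" "reduction F d' d" "forces F d Y"
  shows "forces F d' Y"
  using assms(3) FR_reduction_subset[OF assms(1) reduction_tail_seq[OF assms(1,2)]]
  unfolding forces_def by blast

lemma forces_Int:
  assumes "operation_algebra F" "forces F d Y" "forces F d Z"
  shows "forces F d (Y \<inter> Z)"
proof -
  obtain i j where "FR F (tail_seq d i) \<subseteq> Y" "FR F (tail_seq d j) \<subseteq> Z"
    using assms(2,3) by (auto simp: forces_def)
  then have "FR F (tail_seq d (max i j)) \<subseteq> Y \<inter> Z"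
    using FR_tail_seq_antimono[OF assms(1), of i "max i j" d]
      FR_tail_seq_antimono[OF assms(1), of j "max i j" d] by auto
  then show ?thesis by (auto simp: forces_def)
qed

lemma not_forces_empty: "\<not> forces F d {}"
  using FR_nonempty by (auto simp: forces_def)

lemma ramsey_algebra_decide_countable:
  assumes R: "ramsey_algebra F" and C: "countable C"
  shows "\<exists>d'. reduction F d' d \<and> (\<forall>Y\<in>C. forces F d' Y \<or> forces F d' (- Y))"
proof -
  have F: "operation_algebra F" using R by (simp add: ramsey_algebra_def)
  have dec: "\<exists>b. reduction F b a \<and> (FR F b \<subseteq> X \<or> FR F b \<subseteq> - X)" for a X
    using R unfolding ramsey_algebra_def by (metis disjoint_eq_subset_Compl)
  \<comment> \<open>Adding \<open>{}\<close> makes the set nonempty, so that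
    \<open>from_nat_into\<close> enumerates exactly its elements even if \<open>C\<close> is
    empty.\<close>
  define X where "X = from_nat_into (insert {} C)"
  \<comment> \<open>Each stage drops the first entry before deciding the next set; this is the form
    that \<open>diagonal_reduction\<close> needs.\<close>
  have "\<exists>c. \<forall>n. ((n = 0 \<longrightarrow> reduction F (c n) d) \<and> (FR F (c n) \<subseteq> X n \<or> FR F (c n) \<subseteq> - X n)) \<and>
      reduction F (c (Suc n)) (tail_seq (c n) 1)"
  proof (rule dependent_nat_choice, goal_cases)
    case 1
    show ?case using dec[of d "X 0"] by blast
  next
    case (2 x n)
    show ?case using dec[of "tail_seq x 1" "X (Suc n)"] by auto
  qed
  then obtain c where c: "reduction F (c 0) d" "\<And>n. FR F (c n) \<subseteq> X n \<or> FR F (c n) \<subseteq> - X n"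
    "\<And>n. reduction F (c (Suc n)) (tail_seq (c n) 1)"
    by metis
  let ?d = "\<lambda>n. c n 0"
  \<comment> \<open>The tail of the diagonal from \<open>j\<close> on is the diagonal of the
    sequences from \<open>c j\<close> on, so it inherits the decision that \<open>c j\<close> makes
    about \<open>X j\<close>.\<close>
  have tail: "reduction F (tail_seq ?d j) (c j)" for j
    using diagonal_reduction[OF F, of "\<lambda>n. c (j + n)"] c(3) by (simp add: tail_seq_def)
  have "reduction F ?d (c 0)" by (rule diagonal_reduction[OF F, of c, OF c(3)])
  then have "reduction F ?d d" using c(1) reduction_trans[OF F] by blast
  moreover have "forces F ?d Y \<or> forces F ?d (- Y)" if Y: "Y \<in> C" for Y
  proof -
    obtain n where "Y = X n"
      using from_nat_into_surj[of "insert {} C" Y] C Y by (auto simp: X_def)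
    then show ?thesis
      using c(2)[of n] FR_reduction_subset[OF F tail[of n]] unfolding forces_def by blast
  qed
  ultimately show ?thesis by blast
qed

section \<open>The construction\<close>

definition op_preimage :: "nat operation \<Rightarrow> nat \<Rightarrow> nat list set \<Rightarrow> nat list set" where
  "op_preimage f m X = {as @ bs | as bs. as \<in> tuples (m - 1) \<and> bs \<in> tuples (arity f) \<and>
     as @ [apply_op f bs] \<in> X}"

text \<open>Each clause performs one closure condition once. The ultrafilter does not exist yet, so
  membership in it is replaced by \<open>forces F d\<close>; the last clause supplies the sets that
  witness strong reductibility.\<close>

definition closure_step ::
    "nat operation set \<Rightarrow> (nat \<Rightarrow> nat) \<Rightarrow> (nat \<Rightarrow> nat list set set) \<Rightarrow> nat \<Rightarrow> nat list set set" where
  "closure_step F d A n =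
     A n \<union> (\<lambda>X. tuples n - X) ` A n \<union> (\<lambda>(X, Y). X \<union> Y) ` (A n \<times> A n)
     \<union> (\<lambda>X. {as @ [a] | a as. a # as \<in> X}) ` A n
     \<union> (\<Union>a. (\<lambda>X. {as. a # as \<in> X}) ` A (Suc n))
     \<union> (\<Union>f\<in>F. \<Union>m\<in>{m. 1 \<le> m \<and> n = m + arity f - 1}. op_preimage f m ` A m)
     \<union> (\<lambda>X. {as \<in> tuples n. forces F d {a. as @ [a] \<in> X}}) ` A (Suc n)
     \<union> {(\<lambda>x. [x]) ` FR F (tail_seq d j) | j. n = 1}"

lemma closure_stepI:
  assumes "X \<in> A n"
  shows "X \<in> closure_step F d A n"
    and "tuples n - X \<in> closure_step F d A n"
    and "Y \<in> A n \<Longrightarrow> X \<union> Y \<in> closure_step F d A n"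
    and "{as @ [a] | a as. a # as \<in> X} \<in> closure_step F d A n"
    and "n = Suc m \<Longrightarrow> {as. a # as \<in> X} \<in> closure_step F d A m"
    and "f \<in> F \<Longrightarrow> 1 \<le> n \<Longrightarrow> op_preimage f n X \<in> closure_step F d A (n + arity f - 1)"
    and "n = Suc m \<Longrightarrow> {as \<in> tuples m. forces F d {a. as @ [a] \<in> X}} \<in> closure_step F d A m"
  using assms unfolding closure_step_def by fast+

lemma closure_step_FR: "(\<lambda>x. [x]) ` FR F (tail_seq d j) \<in> closure_step F d A 1"
  unfolding closure_step_def by blast

lemma countable_closure_step:
  assumes "countable F" "\<And>n. countable (A n)"
  shows "countable (closure_step F d A n)"
proof -
  have "countable {(\<lambda>x. [x]) ` FR F (tail_seq d j) | j. n = 1}"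
    by (rule countable_subset[of _ "range (\<lambda>j. (\<lambda>x. [x]) ` FR F (tail_seq d j))"]) auto
  then show ?thesis
    unfolding closure_step_def using assms
    by (intro countable_Un countable_UN countable_image countable_SIGMA) auto
qed

lemma closure_step_subset_tuples:
  assumes "\<And>n. A n \<subseteq> Pow (tuples n)"
  shows "closure_step F d A n \<subseteq> Pow (tuples n)"
proof -
  have len: "X \<in> A m \<Longrightarrow> as \<in> X \<Longrightarrow> length as = m" for X m as
    using assms[of m] by (auto simp: tuples_def)
  show ?thesis
    unfolding closure_step_def op_preimage_def tuples_def
    by (auto dest: len)
qed

text \<open>Families and sequences are chosen alternately: \<open>d k\<close> has to decide the
  sections of the sets in \<open>A k\<close>, while \<open>A (Suc k)\<close> is defined from
  \<open>d k\<close>. Countability of each stage is what allows the next decision.\<close>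

lemma exists_family_chain:
  fixes F :: "nat operation set" and B :: "nat \<Rightarrow> nat list set set"
  assumes R: "ramsey_algebra F" and "countable F"
    and B: "\<And>n. countable (B n)" "\<And>n. B n \<subseteq> Pow (tuples n)"
  shows "\<exists>A d. A 0 = B \<and> reduction F (d 0) d0 \<and>
    (\<forall>k n. countable (A k n)) \<and> (\<forall>k n. A k n \<subseteq> Pow (tuples n)) \<and>
    (\<forall>k n as X. X \<in> A k n \<longrightarrow> forces F (d k) {a. as @ [a] \<in> X} \<or> forces F (d k) (- {a. as @ [a] \<in> X})) \<and>
    (\<forall>k. A (Suc k) = closure_step F (d k) (A k)) \<and> (\<forall>k. reduction F (d (Suc k)) (d k))"
proof -
  have dec: "\<exists>d'. reduction F d' d \<and> (\<forall>n as X. X \<in> A n \<longrightarrow>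
      forces F d' {a. as @ [a] \<in> X} \<or> forces F d' (- {a. as @ [a] \<in> X}))"
    if A: "\<And>n. countable (A n)" for d and A :: "nat \<Rightarrow> nat list set set"
  proof -
    \<comment> \<open>There are only countably many lists of naturals, hence countably many
      sections.\<close>
    have "countable (\<Union>n. \<Union>as. (\<lambda>X. {a. as @ [a] \<in> X}) ` A n)"
      using A by simp
    from ramsey_algebra_decide_countable[OF R this, of d] show ?thesis by auto
  qed
  \<comment> \<open>A state is a pair of a family and a sequence; the condition for
    \<open>k = 0\<close> fixes the starting point within the dependent choice.\<close>
  let ?P = "\<lambda>k x. (k = 0 \<longrightarrow> fst x = B \<and> reduction F (snd x) d0) \<and>
    (\<forall>n. countable (fst x n) \<and> fst x n \<subseteq> Pow (tuples n)) \<and>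
    (\<forall>n as X. X \<in> fst x n \<longrightarrow>
      forces F (snd x) {a. as @ [a] \<in> X} \<or> forces F (snd x) (- {a. as @ [a] \<in> X}))"
  let ?Q = "\<lambda>x y. fst y = closure_step F (snd x) (fst x) \<and> reduction F (snd y) (snd x)"
  have "\<exists>s. \<forall>k. ?P k (s k) \<and> ?Q (s k) (s (Suc k))"
  proof (rule dependent_nat_choice, goal_cases)
    case 1
    obtain d where "reduction F d d0" "\<forall>n as X. X \<in> B n \<longrightarrow>
      forces F d {a. as @ [a] \<in> X} \<or> forces F d (- {a. as @ [a] \<in> X})"
      using dec[of B] B(1) by blast
    then show ?case using B by (intro exI[of _ "(B, d)"]) auto
  next
    case (2 x k)
    let ?A = "closure_step F (snd x) (fst x)"
    have x: "countable (fst x n)" "fst x n \<subseteq> Pow (tuples n)" for n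
      using 2 by simp_all
    have A: "countable (?A n)" "?A n \<subseteq> Pow (tuples n)" for n
      by (rule countable_closure_step[OF assms(2) x(1)] closure_step_subset_tuples[OF x(2)])+
    obtain d where "reduction F d (snd x)" "\<forall>n as X. X \<in> ?A n \<longrightarrow>
      forces F d {a. as @ [a] \<in> X} \<or> forces F d (- {a. as @ [a] \<in> X})"
      using dec[of ?A] A(1) by blast
    then show ?case using A by (intro exI[of _ "(?A, d)"]) auto
  qed
  then obtain s where "\<forall>k. ?P k (s k) \<and> ?Q (s k) (s (Suc k))" ..
  then show ?thesis
    by (intro exI[of _ "\<lambda>k. fst (s k)"] exI[of _ "\<lambda>k. snd (s k)"]) simp
qed

section \<open>The limit family and its ultrafilter\<close>

theorem theorem5p8:
  fixes F :: "nat operation set" and S :: "nat \<Rightarrow> nat list set set"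
  assumes "nondegenerate_ramsey_algebra F"
    and "countable F"
    and "\<And>n. n \<ge> 1 \<Longrightarrow> S n \<subseteq> Pow (tuples n)"
    and "\<And>n. n \<ge> 1 \<Longrightarrow> countable (S n)"
  shows "\<exists>A. admissible_family A \<and>
    (\<forall>n\<ge>1. countable (A n) \<and> S n \<subseteq> A n) \<and>
    (\<forall>f\<in>F. family_operation A f) \<and>
    (\<exists>U. family_ultrafilter A U \<and> \<not> principal_on UNIV (unary_field A) U \<and>
         strongly_reductible F U)"
proof -
  have R: "ramsey_algebra F" and F: "operation_algebra F"
    using assms(1) by (auto simp: nondegenerate_ramsey_algebra_def ramsey_algebra_def)
  \<comment> \<open>Failure of degeneracy yields a sequence below which no \<open>FR\<close> set is
    a singleton.\<close>
  obtain d0 where d0: "\<And>b. reduction F b d0 \<Longrightarrow> card (FR F b) \<noteq> 1"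
    using assms(1) F
    by (auto simp: nondegenerate_ramsey_algebra_def degenerate_ramsey_algebra_def)
  \<comment> \<open>The empty set and the singletons suffice as a start, since complements and
    unions are added later. The value at 0 is empty because nothing is assumed about
    \<open>S 0\<close>.\<close>
  define B where "B n = (if n = 0 then {} else S n \<union> insert {} ((\<lambda>s. {s}) ` tuples n))" for n
  have B: "countable (B n)" "B n \<subseteq> Pow (tuples n)" for n
    using assms(3,4)[of n] by (auto simp: B_def)
  obtain A d where A0: "A 0 = B" and d_0: "reduction F (d 0) d0"
    and count: "\<And>k n. countable (A k n)" and sub: "\<And>k n. A k n \<subseteq> Pow (tuples n)"
    and dec: "\<And>k n as X. X \<in> A k n \<Longrightarrow>
      forces F (d k) {a. as @ [a] \<in> X} \<or> forces F (d k) (- {a. as @ [a] \<in> X})"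
    and A_Suc: "\<And>k. A (Suc k) = closure_step F (d k) (A k)"
    and d_Suc: "\<And>k. reduction F (d (Suc k)) (d k)"
    using exists_family_chain[OF R assms(2), of B d0] B by metis
  define L where "L n = (\<Union>k. A k n)" for n
  have step: "X \<in> L n" if "X \<in> closure_step F (d k) (A k) n" for X n k
    using that by (auto simp: L_def A_Suc[symmetric])
  have A_mono: "A k n \<subseteq> A k' n" if "k \<le> k'" for k k' n
    using that by (rule lift_Suc_mono_le[of "\<lambda>k. A k n", rotated])
      (auto simp: A_Suc intro: closure_stepI)
  have B_L: "B n \<subseteq> L n" for n using A0 by (auto simp: L_def)
  have L_Un: "X \<union> Y \<in> L n" if XY: "X \<in> L n" "Y \<in> L n" for X Y n
  proof -
    obtain k l where "X \<in> A k n" "Y \<in> A l n" using XY by (auto simp: L_def)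
    then have "X \<in> A (max k l) n" "Y \<in> A (max k l) n"
      using A_mono[of k "max k l" n] A_mono[of l "max k l" n] by auto
    then show ?thesis by (intro step closure_stepI(3))
  qed
  have L_compl: "tuples n - X \<in> L n" if X: "X \<in> L n" for X n
  proof -
    obtain k where k: "X \<in> A k n" using X by (auto simp: L_def)
    show ?thesis by (rule step[OF closure_stepI(2)[where A = "A k", OF k]])
  qed
  have L_rotate: "{as @ [a] | a as. a # as \<in> X} \<in> L n" if X: "X \<in> L n" for X n
  proof -
    obtain k where k: "X \<in> A k n" using X by (auto simp: L_def)
    show ?thesis by (rule step[OF closure_stepI(4)[where A = "A k", OF k]])
  qed
  have L_section: "{as. a # as \<in> X} \<in> L n" if X: "X \<in> L (Suc n)" for X n a
  proof -
    obtain k where k: "X \<in> A k (Suc n)" using X by (auto simp: L_def)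
    show ?thesis by (rule step[OF closure_stepI(5)[where A = "A k", OF k refl]])
  qed
  have L_op: "op_preimage f n X \<in> L (n + arity f - 1)" if X: "X \<in> L n" "f \<in> F" "1 \<le> n" for f n X
  proof -
    obtain k where k: "X \<in> A k n" using X by (auto simp: L_def)
    show ?thesis by (rule step[OF closure_stepI(6)[where A = "A k", OF k that(2,3)]])
  qed
  \<comment> \<open>Fixing a whole prefix by iterated sections places the sets
    \<open>{a. as @ [a] \<in> X}\<close> in the unary field, as membership in \<open>U\<close>
    demands.\<close>
  have L_sections: "{xs. as @ xs \<in> X} \<in> L n" if "X \<in> L (length as + n)" for as n X
    using that
  proof (induction as arbitrary: X)
    case (Cons a as)
    then have "{xs. a # xs \<in> X} \<in> L (length as + n)" using L_section by simp
    from Cons.IH[OF this] show ?case by simp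
  qed simp
  have alg: "algebra (tuples n) (L n)" if "1 \<le> n" for n
    using that sub L_compl L_Un B_L[of n] by (auto simp: algebra_iff_Un L_def B_def)
  have field: "field_of_sets (tuples n) (L n)" if "1 \<le> n" for n
    using alg[OF that] B_L[of n] that by (auto simp: field_of_sets_def B_def)
  have adm: "admissible_family L"
    unfolding admissible_family_def
  proof (intro conjI allI impI ballI field L_rotate)
    fix n X a assume "2 \<le> n" "X \<in> L n"
    then show "{as. a # as \<in> X} \<in> L (n - 1)" using L_section[of X "n - 1"] by simp
  qed
  have ops: "family_operation L f" if "f \<in> F" for f
    using L_op[OF _ that] by (simp add: family_operation_def op_preimage_def)
  have count_L: "countable (L n)" for n using count by (simp add: L_def)
  have S_L: "S n \<subseteq> L n" if "1 \<le> n" for n using B_L[of n] that by (auto simp: B_def)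

  define U where "U = {Y \<in> unary_field L. \<exists>k. forces F (d k) Y}"
  have d_mono: "forces F (d k') Y" if "forces F (d k) Y" "k \<le> k'" for k k' Y
    using that(2,1) forces_reduction[OF F d_Suc] by (induction rule: dec_induct) auto
  \<comment> \<open>If \<open>d k\<close> does not force the section, it forces the complement; this
    persists to a common later stage and contradicts forcing at any \<open>l\<close>. So stage
    \<open>k\<close> already settles the ultrafilter quantifier for sets in
    \<open>A k\<close>.\<close>
  have decide: "forces F (d k) {a. as @ [a] \<in> X} \<longleftrightarrow> (\<exists>l. forces F (d l) {a. as @ [a] \<in> X})"
    if X: "X \<in> A k n" for as k n X
  proof
    let ?Y = "{a. as @ [a] \<in> X}"
    assume "\<exists>l. forces F (d l) ?Y"
    then obtain l where l: "forces F (d l) ?Y" ..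
    show "forces F (d k) ?Y"
    proof (rule ccontr)
      assume "\<not> forces F (d k) ?Y"
      then have "forces F (d (max k l)) (- ?Y)" using dec[OF X] d_mono[of k] by fastforce
      moreover have "forces F (d (max k l)) ?Y" using l d_mono by fastforce
      ultimately show False
        using forces_Int[OF F, of "d (max k l)" ?Y "- ?Y"] not_forces_empty[of F "d (max k l)"] by simp
    qed
  qed blast
  have img_UNIV: "(\<lambda>x. [x]) ` UNIV = tuples 1"
    by (auto simp: tuples_def length_Suc_conv)
  have unary_alg: "algebra UNIV (unary_field L)"
    unfolding algebra_iff_Un unary_field_def
  proof (intro conjI ballI)
    fix X assume "X \<in> {X. (\<lambda>x. [x]) ` X \<in> L 1}"
    moreover have "(\<lambda>x. [x]) ` (UNIV - X) = tuples 1 - (\<lambda>x. [x]) ` X"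
      unfolding img_UNIV[symmetric] by (rule image_set_diff) (simp add: inj_on_def)
    ultimately show "UNIV - X \<in> {X. (\<lambda>x. [x]) ` X \<in> L 1}"
      using L_compl[of "(\<lambda>x. [x]) ` X" 1] by simp
  qed (use algebra_iff_Un[THEN iffD1, OF alg[of 1]] in \<open>auto simp: image_Un\<close>)
  then interpret UA: algebra UNIV "unary_field L" .
  have "ultrafilter_on UNIV (unary_field L) U"
    unfolding ultrafilter_on_def
  proof (intro conjI ballI)
    show "U \<subseteq> unary_field L" by (auto simp: U_def)
    show "UNIV \<in> U" by (auto simp: U_def forces_def UA.top[simplified])
    show "{} \<notin> U" by (auto simp: U_def not_forces_empty)
  next
    fix X Y assume XY: "X \<in> U" "Y \<in> U"
    then obtain k l where "forces F (d k) X" "forces F (d l) Y" by (auto simp: U_def)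
    then have "forces F (d (max k l)) (X \<inter> Y)"
      using d_mono by (intro forces_Int[OF F]) fastforce+
    then show "X \<inter> Y \<in> U" using XY by (auto simp: U_def)
  next
    fix X assume X: "X \<in> unary_field L"
    then obtain k where k: "(\<lambda>x. [x]) ` X \<in> A k 1" by (auto simp: unary_field_def L_def)
    \<comment> \<open>The empty prefix recovers the unary set itself as a section.\<close>
    have "{a. [] @ [a] \<in> (\<lambda>x. [x]) ` X} = X" by auto
    then have "forces F (d k) X \<or> forces F (d k) (- X)"
      using dec[OF k, of "[]"] by simp
    then show "X \<in> U \<or> UNIV - X \<in> U"
      using X UA.compl_sets[OF X] by (auto simp: U_def Compl_eq_Diff_UNIV)
  qed
  moreover have "{as \<in> tuples n. {a. as @ [a] \<in> X} \<in> U} \<in> L n" if X: "X \<in> L (n + 1)" for n X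
  proof -
    obtain k where k: "X \<in> A k (Suc n)" using X by (auto simp: L_def)
    \<comment> \<open>On \<open>A k\<close> the quantifier over \<open>U\<close> thus agrees with
      the one over \<open>d k\<close>, whose result was put into \<open>A (Suc k)\<close>.\<close>
    have "{a. as @ [a] \<in> X} \<in> U \<longleftrightarrow> forces F (d k) {a. as @ [a] \<in> X}" if as: "as \<in> tuples n" for as
    proof -
      have "{xs. as @ xs \<in> X} \<in> L 1" using L_sections[of X as 1] X as by (simp add: tuples_def)
      moreover have "{xs. as @ xs \<in> X} = (\<lambda>a. [a]) ` {a. as @ [a] \<in> X}"
      proof -
        have "length xs = 1" if "as @ xs \<in> X" for xs
          using sub[of k "Suc n"] k as that by (fastforce simp: tuples_def)
        then show ?thesis by (fastforce simp: length_Suc_conv)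
      qed
      ultimately show ?thesis using decide[OF k] by (simp add: U_def unary_field_def)
    qed
    then have "{as \<in> tuples n. {a. as @ [a] \<in> X} \<in> U} =
        {as \<in> tuples n. forces F (d k) {a. as @ [a] \<in> X}}" by blast
    then show ?thesis
      by (simp only:) (rule step[OF closure_stepI(7)[where A = "A k", OF k refl]])
  qed
  ultimately have "family_ultrafilter L U" by (simp add: family_ultrafilter_def)
  moreover have "\<not> principal_on UNIV (unary_field L) U"
  proof
    assume "principal_on UNIV (unary_field L) U"
    then obtain a where a: "U = {X \<in> unary_field L. a \<in> X}" by (auto simp: principal_on_def)
    \<comment> \<open>A principal \<open>U\<close> would contain \<open>{a}\<close>, so some tail of
      some \<open>d k\<close> would have a singleton \<open>FR\<close>; but that tail reduces
      \<open>d0\<close>.\<close>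
    have "{[a]} \<in> L 1" using B_L[of 1] by (auto simp: B_def tuples_def)
    then have "{a} \<in> U" by (simp add: a unary_field_def)
    then obtain k j where "FR F (tail_seq (d k) j) \<subseteq> {a}" by (auto simp: U_def forces_def)
    then have "FR F (tail_seq (d k) j) = {a}"
      using FR_nonempty[of F "tail_seq (d k) j"] by blast
    moreover have "reduction F (d k) d0"
      by (induction k) (use d_0 d_Suc reduction_trans[OF F] in blast)+
    then have "reduction F (tail_seq (d k) j) d0"
      using reduction_trans[OF F reduction_tail_seq_self[OF F]] by blast
    ultimately show False using d0 by fastforce
  qed
  moreover have "strongly_reductible F U"
    unfolding strongly_reductible_def
  proof
    fix X assume "X \<in> U"
    then obtain k j where kj: "FR F (tail_seq (d k) j) \<subseteq> X" by (auto simp: U_def forces_def)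
    \<comment> \<open>This set belongs to \<open>A (Suc k) 1\<close> by the last clause of
      \<open>closure_step\<close>, and \<open>d k\<close> forces it trivially.\<close>
    have "FR F (tail_seq (d k) i) \<in> U" for i
      using step[OF closure_step_FR] by (auto simp: U_def unary_field_def forces_def)
    then show "\<exists>a. FR F a \<subseteq> X \<and> (\<forall>i. FR F (tail_seq a i) \<in> U)"
      using kj by (intro exI[of _ "tail_seq (d k) j"]) (simp add: tail_seq_tail_seq)
  qed
  ultimately show ?thesis
    using adm ops count_L S_L by (intro exI[of _ L] conjI exI[of _ U]) auto
qed

end
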